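(* Let $r\ge 4$ be an integer. Then for all positive integers $k$ there is a graph $G$ on $n=kr$ vertices whose minimum degree is $$\left\lceil\left(1-\frac{1}{\chi_{cr}(K_r^-)}\right)n\right\rceil-1$$ but which does not contain a perfect $K_r^-$-packing.
   Context: All graphs are finite and simple. $K_r^-$ denotes the graph obtained from the complete graph $K_r$ by deleting one edge. Given graphs $H$ and $G$, an $H$-packing in $G$ is a collection of vertex-disjoint copies of $H$ in $G$ (copies are not necessarily induced subgraphs); it is perfect if it covers all vertices of $G$. The critical chromatic number of a graph $H$ is $\chi_{cr}(H):=(\chi(H)-1)|H|/(|H|-\sigma(H))$, where $\chi(H)$ is the chromatic number, $|H|$ is the order (number of vertices) of $H$, and $\sigma(H)$ is the minimum size of the smallest colour class over all proper colourings of $H$ with $\chi(H)$ colours. In particular $\chi_{cr}(K_r^-)=\frac{r(r-2)}{r-1}$. *)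

theory Defs
  imports
    Complex_Main
    "Graph_Theory.Pair_Digraph"
    "Graph_Theory.Digraph_Isomorphism"
    "Graph_Theory.Kuratowski"
begin

text \<open>
  Finite simple graphs are \<^const>\<open>pair_graph\<close>s, that is, finite loop-free symmetric relations on a
  finite vertex set: an edge between \<open>u\<close> and \<open>v\<close> is present as both arcs \<open>(u, v)\<close> and \<open>(v, u)\<close>.
\<close>

definition complete_pair_graph :: "nat \<Rightarrow> nat pair_pre_digraph" where
  "complete_pair_graph r =
     \<lparr>pverts = {..<r}, parcs = {(u, v). u \<in> {..<r} \<and> v \<in> {..<r} \<and> u \<noteq> v}\<rparr>"

lemma complete_digraph_complete_pair_graph: "complete_digraph r (complete_pair_graph r)"
  by (simp add: complete_digraph_pair_def complete_pair_graph_def)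

text \<open>
  All choices of the deleted edge give isomorphic graphs; \<open>{0, 1}\<close> is an edge for \<open>r \<ge> 2\<close>.
\<close>

definition complete_minus_edge :: "nat \<Rightarrow> nat pair_pre_digraph" where
  "complete_minus_edge r =
     \<lparr>pverts = pverts (complete_pair_graph r),
      parcs = parcs (complete_pair_graph r) - {(0, 1), (1, 0)}\<rparr>"

lemma pair_graph_complete_minus_edge: "pair_graph (complete_minus_edge r)"
proof
  show "finite (parcs (complete_minus_edge r))"
    by (rule finite_subset[of _ "{..<r} \<times> {..<r}"])
      (auto simp: complete_minus_edge_def complete_pair_graph_def)
qed (auto simp: complete_minus_edge_def complete_pair_graph_def symmetric_def intro!: symI)

text \<open>Every edge at \<open>v\<close> contributes exactly one outgoing arc, so the out-degree is the degree.\<close>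

definition min_degree :: "'a pair_pre_digraph \<Rightarrow> nat" where
  "min_degree G = Min (out_degree G ` pverts G)"

definition proper_colouring :: "'a pair_pre_digraph \<Rightarrow> nat \<Rightarrow> ('a \<Rightarrow> nat) \<Rightarrow> bool" where
  "proper_colouring G k c \<longleftrightarrow>
     (\<forall>v \<in> pverts G. c v < k) \<and> (\<forall>(u, v) \<in> parcs G. c u \<noteq> c v)"

definition chromatic_number :: "'a pair_pre_digraph \<Rightarrow> nat" where
  "chromatic_number G = (LEAST k. \<exists>c. proper_colouring G k c)"

definition colour_class :: "'a pair_pre_digraph \<Rightarrow> ('a \<Rightarrow> nat) \<Rightarrow> nat \<Rightarrow> 'a set" where
  "colour_class G c i = {v \<in> pverts G. c v = i}"

text \<open>
  A proper colouring with \<^const>\<open>chromatic_number\<close> many colours uses all of them, so no empty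
  class enters the minimum.
\<close>

definition min_colour_class_size :: "'a pair_pre_digraph \<Rightarrow> nat" where
  "min_colour_class_size G =
     Inf {Min ((\<lambda>i. card (colour_class G c i)) ` {..<chromatic_number G}) | c.
       proper_colouring G (chromatic_number G) c}"

definition critical_chromatic_number :: "'a pair_pre_digraph \<Rightarrow> real" where
  "critical_chromatic_number G =
     (real (chromatic_number G) - 1) * real (card (pverts G)) /
     (real (card (pverts G)) - real (min_colour_class_size G))"

definition is_copy_in :: "'b pair_pre_digraph \<Rightarrow> 'a pair_pre_digraph \<Rightarrow> 'a pair_pre_digraph \<Rightarrow> bool" where
  "is_copy_in H G C \<longleftrightarrow> subgraph C G \<and> digraph_iso H C"

definition packing :: "'b pair_pre_digraph \<Rightarrow> 'a pair_pre_digraph \<Rightarrow> 'a pair_pre_digraph set \<Rightarrow> bool" where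
  "packing H G P \<longleftrightarrow>
     (\<forall>C \<in> P. is_copy_in H G C) \<and> pairwise (\<lambda>C D. disjnt (pverts C) (pverts D)) P"

definition perfect_packing :: "'b pair_pre_digraph \<Rightarrow> 'a pair_pre_digraph \<Rightarrow> 'a pair_pre_digraph set \<Rightarrow> bool" where
  "perfect_packing H G P \<longleftrightarrow> packing H G P \<and> (\<Union>C \<in> P. pverts C) = pverts G"

end

theory Submission
  imports Defs
begin

text \<open>
  Put \<open>m = k + k div (r - 2) + 1\<close> and let \<open>G\<close> be the complete multipartite graph on \<open>k * r\<close>
  vertices all of whose parts have size \<open>m\<close>, except possibly a smaller last one. Its minimum
  degree is \<open>k * r - m\<close>, which is the required value. Fewer than \<open>k\<close> vertices lie outside the
  first \<open>r - 2\<close> parts, whereas each copy of \<open>K\<^sub>r\<^sup>-\<close>, containing a clique of order \<open>r - 1\<close>,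
  must use one of them; so there are fewer than \<open>k\<close> disjoint copies.
\<close>

section \<open>The critical chromatic number of \<open>K\<^sub>r\<^sup>-\<close>\<close>

lemma pverts_complete_minus_edge [simp]: "pverts (complete_minus_edge r) = {..<r}"
  by (simp add: complete_minus_edge_def complete_pair_graph_def)

lemma parcs_complete_minus_edge:
  "(u, v) \<in> parcs (complete_minus_edge r) \<longleftrightarrow>
     u < r \<and> v < r \<and> u \<noteq> v \<and> (u, v) \<noteq> (0, 1) \<and> (u, v) \<noteq> (1, 0)"
  by (auto simp: complete_minus_edge_def complete_pair_graph_def)

text \<open>The deleted edge joins 0 and 1, so the vertices from 1 to \<open>r - 1\<close> still
  form a clique.\<close>

lemma proper_colouring_complete_minus_edge_inj_on:
  assumes "proper_colouring (complete_minus_edge r) k c"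
  shows "inj_on c {1..<r}"
proof (rule inj_onI, rule ccontr)
  fix u v assume "u \<in> {1..<r}" "v \<in> {1..<r}" "c u = c v" "u \<noteq> v"
  then have "(u, v) \<in> parcs (complete_minus_edge r)"
    by (auto simp: parcs_complete_minus_edge)
  then show False
    using assms \<open>c u = c v\<close> by (auto simp: proper_colouring_def)
qed

text \<open>Serves twice: for the chromatic number, and later to force each copy out of the first
  \<open>r - 2\<close> parts.\<close>

lemma proper_colouring_complete_minus_edge_le:
  assumes "proper_colouring (complete_minus_edge r) k c"
  shows "r - 1 \<le> k"
proof -
  have "c ` {1..<r} \<subseteq> {..<k}"
    using assms by (auto simp: proper_colouring_def)
  then have "card {1..<r} \<le> card {..<k}"
    by (intro card_inj_on_le[OF proper_colouring_complete_minus_edge_inj_on[OF assms]]) auto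
  then show ?thesis by simp
qed

text \<open>Truncated subtraction gives 0 and 1, the only non-adjacent pair, the same colour
  0.\<close>

lemma proper_colouring_complete_minus_edge_diff_1:
  assumes "r \<ge> 2"
  shows "proper_colouring (complete_minus_edge r) (r - 1) (\<lambda>v. v - 1)"
  using assms by (auto simp: proper_colouring_def parcs_complete_minus_edge)

lemma chromatic_number_complete_minus_edge:
  assumes "r \<ge> 2"
  shows "chromatic_number (complete_minus_edge r) = r - 1"
  unfolding chromatic_number_def
  using proper_colouring_complete_minus_edge_diff_1[OF assms]
    proper_colouring_complete_minus_edge_le
  by (intro Least_equality) blast+

lemma min_colour_class_size_complete_minus_edge:
  assumes "r \<ge> 3"
  shows "min_colour_class_size (complete_minus_edge r) = 1"
proof -
  let ?H = "complete_minus_edge r"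
  let ?M = "\<lambda>c. Min ((\<lambda>i. card (colour_class ?H c i)) ` {..<r - 1})"
  let ?S = "{?M c | c. proper_colouring ?H (r - 1) c}"
  have fin: "finite (colour_class ?H c i)" for c i
    by (simp add: colour_class_def)
  have ge: "1 \<le> ?M c" if c: "proper_colouring ?H (r - 1) c" for c
  proof -
    \<comment> \<open>The clique has as many vertices as there are colours, so it meets every colour
      class.\<close>
    have "c ` {1..<r} = {..<r - 1}"
    proof (rule card_subset_eq)
      show "c ` {1..<r} \<subseteq> {..<r - 1}"
        using c by (auto simp: proper_colouring_def)
      show "card (c ` {1..<r}) = card {..<r - 1}"
        using card_image[OF proper_colouring_complete_minus_edge_inj_on[OF c]] by simp
    qed simp
    have "1 \<le> card (colour_class ?H c i)" if "i < r - 1" for i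
    proof -
      have "i \<in> c ` {1..<r}"
        using that \<open>c ` {1..<r} = {..<r - 1}\<close> by blast
      then have "colour_class ?H c i \<noteq> {}"
        by (auto simp: colour_class_def)
      then show ?thesis
        using fin[of c i] by (simp add: Suc_le_eq card_gt_0_iff)
    qed
    then show ?thesis
      using assms by (subst Min_ge_iff) (auto simp: lessThan_empty_iff)
  qed
  let ?c = "\<lambda>v::nat. v - 1"
  have c: "proper_colouring ?H (r - 1) ?c"
    using assms by (intro proper_colouring_complete_minus_edge_diff_1) simp
  \<comment> \<open>Colour 0 occurs twice; colour 1, which exists because \<open>r \<ge> 3\<close>,
    gives a singleton class.\<close>
  have "colour_class ?H ?c 1 = {2}"
    using assms by (auto simp: colour_class_def)
  then have "card (colour_class ?H ?c 1) = 1"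
    by simp
  moreover have "?M ?c \<le> card (colour_class ?H ?c 1)"
    using assms by (intro Min_le) auto
  ultimately have "?M ?c = 1"
    using ge[OF c] by simp
  then have "1 \<in> ?S"
    using c by (intro CollectI exI[of _ ?c] conjI) (simp_all only:)
  moreover have "\<And>x. x \<in> ?S \<Longrightarrow> 1 \<le> x"
    using ge by blast
  ultimately have "Inf ?S = 1"
    by (rule cInf_eq_minimum)
  moreover have "chromatic_number ?H = r - 1"
    using assms by (intro chromatic_number_complete_minus_edge) simp
  ultimately show ?thesis
    unfolding min_colour_class_size_def by simp
qed

lemma critical_chromatic_number_complete_minus_edge:
  assumes "r \<ge> 3"
  shows "critical_chromatic_number (complete_minus_edge r) =
    (real r - 2) * real r / (real r - 1)"
  using assms chromatic_number_complete_minus_edge[of r]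
    min_colour_class_size_complete_minus_edge[of r]
  by (simp add: critical_chromatic_number_def of_nat_diff)

text \<open>With \<open>n = k * r\<close>, the quotient of n by the critical chromatic number is k(r
  - 1)/(r - 2) = k + k/(r - 2). Rounding up after subtracting this amounts to subtracting its
  floor.\<close>

lemma ceiling_critical_degree:
  assumes "r \<ge> 3"
  shows "\<lceil>(1 - 1 / critical_chromatic_number (complete_minus_edge r)) * real (k * r)\<rceil> =
    int (k * r) - int k - int (k div (r - 2))"
proof -
  have ceiling_diff: "\<lceil>of_int a - x\<rceil> = a - \<lfloor>x\<rfloor>" for a and x :: real
    by linarith
  have "(1 - 1 / critical_chromatic_number (complete_minus_edge r)) * real (k * r) =
      of_int (int (k * r) - int k) - real k / real (r - 2)"
    using assms
    by (simp add: critical_chromatic_number_complete_minus_edge of_nat_diff divide_simps)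
      (simp add: algebra_simps)
  also have "\<lceil>\<dots>\<rceil> = int (k * r) - int k - \<lfloor>real k / real (r - 2)\<rfloor>"
    by (rule ceiling_diff)
  finally show ?thesis
    by (simp only: floor_divide_of_nat_eq)
qed

section \<open>Complete multipartite graphs\<close>

definition multipartite_graph :: "nat \<Rightarrow> nat \<Rightarrow> nat pair_pre_digraph" where
  "multipartite_graph n m =
     \<lparr>pverts = {..<n}, parcs = {(u, v). u < n \<and> v < n \<and> u div m \<noteq> v div m}\<rparr>"

lemma pverts_multipartite_graph [simp]: "pverts (multipartite_graph n m) = {..<n}"
  by (simp add: multipartite_graph_def)

lemma parcs_multipartite_graph:
  "(u, v) \<in> parcs (multipartite_graph n m) \<longleftrightarrow> u < n \<and> v < n \<and> u div m \<noteq> v div m"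
  by (simp add: multipartite_graph_def)

lemma pair_graph_multipartite_graph: "pair_graph (multipartite_graph n m)"
proof
  show "finite (parcs (multipartite_graph n m))"
    by (rule finite_subset[of _ "{..<n} \<times> {..<n}"]) (auto simp: multipartite_graph_def)
qed (auto simp: multipartite_graph_def symmetric_def intro!: symI)

lemma out_degree_multipartite_graph:
  assumes "v < n"
  shows "out_degree (multipartite_graph n m) v = n - card {u. u < n \<and> u div m = v div m}"
proof -
  let ?B = "{u. u < n \<and> u div m = v div m}"
  have "out_arcs (multipartite_graph n m) v = Pair v ` ({..<n} - ?B)"
    using assms by (auto simp: out_arcs_def multipartite_graph_def)
  then have "out_degree (multipartite_graph n m) v = card ({..<n} - ?B)"
    by (simp add: out_degree_def card_image inj_on_def)
  also have "\<dots> = n - card ?B"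
    by (subst card_Diff_subset) auto
  finally show ?thesis .
qed

text \<open>The parts are blocks of m consecutive numbers cut off at n, and a vertex misses exactly
  its own part. No part exceeds m, and \<open>m \<le> n\<close> makes the part of 0 attain
  it.\<close>

lemma min_degree_multipartite_graph:
  assumes "0 < m" "m \<le> n"
  shows "min_degree (multipartite_graph n m) = n - m"
  unfolding min_degree_def
proof (rule Min_eqI)
  show "finite (out_degree (multipartite_graph n m) ` pverts (multipartite_graph n m))"
    by simp
next
  fix d assume "d \<in> out_degree (multipartite_graph n m) ` pverts (multipartite_graph n m)"
  then obtain v where v: "v < n" "d = out_degree (multipartite_graph n m) v"
    by auto
  have "{u. u < n \<and> u div m = v div m} \<subseteq> {v div m * m..<v div m * m + m}"
  proof
    fix u assume "u \<in> {u. u < n \<and> u div m = v div m}"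
    then have "u = v div m * m + u mod m"
      by (metis (mono_tags, lifting) div_mult_mod_eq mem_Collect_eq)
    then show "u \<in> {v div m * m..<v div m * m + m}"
      using mod_less_divisor[OF \<open>0 < m\<close>, of u] by simp
  qed
  then have "card {u. u < n \<and> u div m = v div m} \<le> m"
    by (auto dest!: card_mono[rotated])
  then show "n - m \<le> d"
    using v by (simp add: out_degree_multipartite_graph)
next
  have "{u. u < n \<and> u div m = 0 div m} = {..<m}"
    using assms by (auto simp: div_eq_0_iff)
  then have "out_degree (multipartite_graph n m) 0 = n - m"
    using assms by (simp add: out_degree_multipartite_graph)
  then show "n - m \<in> out_degree (multipartite_graph n m) ` pverts (multipartite_graph n m)"
    using assms by (intro image_eqI[of _ _ 0]) auto
qed

section \<open>Copies and packings\<close>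

lemma is_copy_inE:
  assumes "is_copy_in H G C"
  obtains f where "inj_on f (pverts H)" "pverts C = f ` pverts H"
    "\<And>u v. (u, v) \<in> parcs H \<Longrightarrow> (f u, f v) \<in> parcs G"
proof -
  obtain h where h: "pre_digraph.digraph_isomorphism (with_proj H) h"
    and C: "with_proj C = app_iso h (with_proj H)"
    using assms by (auto simp: is_copy_in_def digraph_iso_def)
  \<comment> \<open>An isomorphism carries separate maps for vertices and arcs, as well as tail and
    head functions. As both graphs are pair digraphs, the latter must be \<open>fst\<close> and
    \<open>snd\<close>, so the vertex map determines the arc map.\<close>
  have verts: "pverts C = iso_verts h ` pverts H" and arcs: "parcs C = iso_arcs h ` parcs H"
    and "iso_tail h = fst" "iso_head h = snd"
    using arg_cong[OF C, of verts] arg_cong[OF C, of arcs]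
      arg_cong[OF C, of tail] arg_cong[OF C, of head] by simp_all
  have "(iso_verts h u, iso_verts h v) \<in> parcs G" if "(u, v) \<in> parcs H" for u v
  proof -
    have "iso_arcs h (u, v) = (iso_verts h u, iso_verts h v)"
      using h that \<open>iso_tail h = fst\<close> \<open>iso_head h = snd\<close>
      by (auto simp: pre_digraph.digraph_isomorphism_def prod_eq_iff)
    moreover have "iso_arcs h (u, v) \<in> parcs C"
      using arcs that by blast
    ultimately show ?thesis
      using assms by (auto simp: is_copy_in_def subgraph_def)
  qed
  moreover have "inj_on (iso_verts h) (pverts H)"
    using h by (simp add: pre_digraph.digraph_isomorphism_def)
  ultimately show thesis
    using that verts by blast
qed

text \<open>A copy inside the first \<open>r - 2\<close> parts would be properly coloured by the
  index of the part, with fewer than \<open>r - 1\<close> colours.\<close>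

lemma copy_complete_minus_edge_in_multipartite_graph:
  assumes "is_copy_in (complete_minus_edge r) (multipartite_graph n m) C"
    and "2 \<le> r" "0 < m"
  shows "\<exists>v \<in> pverts C. (r - 2) * m \<le> v \<and> v < n"
proof (rule ccontr)
  assume none: "\<not> ?thesis"
  obtain f where C: "pverts C = f ` {..<r}"
    and arc: "\<And>u v. (u, v) \<in> parcs (complete_minus_edge r) \<Longrightarrow>
      (f u, f v) \<in> parcs (multipartite_graph n m)"
    using is_copy_inE[OF assms(1)] by (metis pverts_complete_minus_edge)
  have "pverts C \<subseteq> {..<n}"
    using assms(1) by (simp add: is_copy_in_def subgraph_def)
  then have "f v div m < r - 2" if "v < r" for v
    using none C that \<open>0 < m\<close> by (force simp: div_less_iff_less_mult not_le)
  then have "proper_colouring (complete_minus_edge r) (r - 2) (\<lambda>v. f v div m)"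
    using arc by (auto simp: proper_colouring_def parcs_multipartite_graph)
  from proper_colouring_complete_minus_edge_le[OF this] show False
    using \<open>2 \<le> r\<close> by simp
qed

lemma card_copy_complete_minus_edge:
  assumes "is_copy_in (complete_minus_edge r) G C"
  shows "card (pverts C) = r"
  using is_copy_inE[OF assms] by (metis card_image card_lessThan pverts_complete_minus_edge)

text \<open>Choosing a vertex of \<open>S\<close> in each copy is injective, because the copies are
  disjoint.\<close>

lemma card_perfect_packing_le:
  assumes P: "perfect_packing H G P"
    and hit: "\<And>C. is_copy_in H G C \<Longrightarrow> \<exists>v \<in> pverts C. v \<in> S" and "finite S"
  shows "finite P" "card P \<le> card S"
proof -
  have "\<exists>g. \<forall>C \<in> P. g C \<in> pverts C \<and> g C \<in> S"
    using P hit unfolding perfect_packing_def packing_def by (intro bchoice) blast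
  then obtain g where g: "\<And>C. C \<in> P \<Longrightarrow> g C \<in> pverts C \<and> g C \<in> S"
    by blast
  have "inj_on g P"
  proof (rule inj_onI, rule ccontr)
    fix C D assume "C \<in> P" "D \<in> P" "g C = g D" "C \<noteq> D"
    then have "disjnt (pverts C) (pverts D)"
      using P by (auto simp: perfect_packing_def packing_def pairwise_def)
    then show False
      using g[OF \<open>C \<in> P\<close>] g[OF \<open>D \<in> P\<close>] \<open>g C = g D\<close> by (auto simp: disjnt_def)
  qed
  moreover have "g ` P \<subseteq> S"
    using g by blast
  ultimately show "finite P" "card P \<le> card S"
    using \<open>finite S\<close> by (auto intro: inj_on_finite card_inj_on_le)
qed

lemma no_perfect_packing_multipartite_graph:
  assumes "2 \<le> r" "0 < m" "0 < k" and small: "k * r < (r - 2) * m + k"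
  shows "\<not> perfect_packing (complete_minus_edge r) (multipartite_graph (k * r) m) P"
proof
  let ?H = "complete_minus_edge r" and ?G = "multipartite_graph (k * r) m"
  assume P: "perfect_packing ?H ?G P"
  let ?S = "{(r - 2) * m..<k * r}"
  have hit: "\<exists>v \<in> pverts C. v \<in> ?S" if "is_copy_in ?H ?G C" for C
    using copy_complete_minus_edge_in_multipartite_graph[OF that] assms by auto
  have "finite P" "card P \<le> card ?S"
    using card_perfect_packing_le[OF P hit] by blast+
  \<comment> \<open>\<open>0 < k\<close> covers the case where \<open>?S\<close> is empty and its
    size is a truncated difference.\<close>
  then have "card P < k"
    using small \<open>0 < k\<close> by simp
  have "k * r = card (\<Union>C \<in> P. pverts C)"
    using P by (simp add: perfect_packing_def)
  also have "\<dots> \<le> (\<Sum>C \<in> P. card (pverts C))"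
    using \<open>finite P\<close> by (rule card_UN_le)
  also have "\<dots> = (\<Sum>C \<in> P. r)"
    using P by (intro sum.cong)
      (auto simp: perfect_packing_def packing_def card_copy_complete_minus_edge)
  also have "\<dots> < k * r"
    using \<open>card P < k\<close> \<open>2 \<le> r\<close> by simp
  finally show False by simp
qed

theorem proposition3:
  fixes r :: nat
  assumes "r \<ge> 4"
  shows "\<forall>k::nat. k > 0 \<longrightarrow>
    (\<exists>G :: nat pair_pre_digraph.
       pair_graph G \<and> card (pverts G) = k * r \<and>
       int (min_degree G) =
         \<lceil>(1 - 1 / critical_chromatic_number (complete_minus_edge r)) * real (k * r)\<rceil> - 1 \<and>
       \<not> (\<exists>P. perfect_packing (complete_minus_edge r) G P))"
proof (intro allI impI)
  fix k :: nat
  assume "k > 0"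
  \<comment> \<open>The least m with (r - 2)m > k(r - 1), that is, leaving fewer than k vertices
    outside the first \<open>r - 2\<close> full-size blocks.\<close>
  define m where "m = k + k div (r - 2) + 1"
  let ?G = "multipartite_graph (k * r) m"
  have "m \<le> k * 3"
    using \<open>k > 0\<close> div_le_dividend[of k "r - 2"] unfolding m_def by linarith
  also have "\<dots> \<le> k * r"
    using assms by (intro mult_le_mono) auto
  finally have "m \<le> k * r" .
  then have "int (min_degree ?G) = int (k * r) - int m"
    by (subst min_degree_multipartite_graph) (auto simp: m_def of_nat_diff)
  then have degree: "int (min_degree ?G) =
      \<lceil>(1 - 1 / critical_chromatic_number (complete_minus_edge r)) * real (k * r)\<rceil> - 1"
    using assms by (subst ceiling_critical_degree) (auto simp: m_def)
  \<comment> \<open>This strict bound from division with remainder is what remains of the required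
    inequality once \<open>(r - 2) * k\<close> and k are cancelled.\<close>
  have "k < (r - 2) * (k div (r - 2) + 1)"
    using assms dividend_less_times_div[of "r - 2" k] by simp
  moreover have "(r - 2) * m = (r - 2) * k + (r - 2) * (k div (r - 2) + 1)"
    by (simp add: m_def algebra_simps)
  moreover have "k * r = (r - 2) * k + 2 * k"
    using assms by (simp add: algebra_simps flip: add_mult_distrib)
  ultimately have "k * r < (r - 2) * m + k"
    by linarith
  then have "\<not> (\<exists>P. perfect_packing (complete_minus_edge r) ?G P)"
    using no_perfect_packing_multipartite_graph[of r m k] assms \<open>k > 0\<close> by (auto simp: m_def)
  with degree show "\<exists>G :: nat pair_pre_digraph.
       pair_graph G \<and> card (pverts G) = k * r \<and>
       int (min_degree G) =
         \<lceil>(1 - 1 / critical_chromatic_number (complete_minus_edge r)) * real (k * r)\<rceil> - 1 \<and>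
       \<not> (\<exists>P. perfect_packing (complete_minus_edge r) G P)"
    using pair_graph_multipartite_graph by (intro exI[of _ ?G]) auto
qed

end
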